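(* Let $Y$ be a doubling metric space, let $X\subset Y$ be a nonempty closed subset, and suppose that $\dim_{\mathrm A}X\le d$. Assume that there is a constant $C_0\ge1$ such that $$N_Y(B_Y(y,R),r)\le C_0\left(\frac Rr\right)^d$$ whenever $y\in Y\setminus X$, $0<R<\frac{\operatorname{dist}(y,X)}2$ and $0<r<R$. Then $\dim_{\mathrm A}Y\le d$.
   Context: For a metric space $Z$, $E\subseteq Z$ and $r>0$, $N_Z(E,r)$ denotes the smallest number of balls of radius $r$ required to cover $E$; $B_Z(z,R)$ is the ball of radius $R$ centered at $z$. The Assouad dimension $\dim_{\mathrm A}Z$ is the infimum of all $s\ge0$ for which there exists $C\ge1$ such that $N_Z(B_Z(z,R),r)\le C(R/r)^s$ for every $z\in Z$ and $0<r<R$. A metric space is doubling if for some $D\ge1$ every ball is covered by at most $D$ balls of half its radius. The subset $X$ carries the restricted metric. *)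

theory Defs
  imports "HOL-Analysis.Analysis" "HOL-Library.Extended_Nat" "HOL-Library.Extended_Real"
begin

text \<open>
  A metric space is a subset \<open>Z\<close> of a type of class \<^class>\<open>metric_space\<close>, with the
  restricted metric. Every notion below is intrinsic to \<open>Z\<close>: balls are relative to \<open>Z\<close>
  and are centred at points of \<open>Z\<close>. Balls are open.
\<close>

definition rel_ball :: "'a::metric_space set \<Rightarrow> 'a \<Rightarrow> real \<Rightarrow> 'a set"
  where "rel_ball Z z r = ball z r \<inter> Z"

text \<open>The value is \<open>\<infinity>\<close>, the infimum of the empty set, if no finite cover exists.\<close>

definition covering_number :: "'a::metric_space set \<Rightarrow> 'a set \<Rightarrow> real \<Rightarrow> enat"
  where "covering_number Z E r =
    Inf {enat (card \<B>) | \<B>. finite \<B> \<and> \<B> \<subseteq> (\<lambda>z. rel_ball Z z r) ` Z \<and> E \<subseteq> \<Union>\<B>}"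

definition doubling :: "'a::metric_space set \<Rightarrow> bool"
  where "doubling Z \<longleftrightarrow>
    (\<exists>D::nat. D \<ge> 1 \<and>
      (\<forall>z\<in>Z. \<forall>R>0. covering_number Z (rel_ball Z z R) (R / 2) \<le> enat D))"

text \<open>Extended-real valued, so that the dimension is \<open>\<infinity>\<close> if no exponent is admissible.\<close>

definition assouad_dim :: "'a::metric_space set \<Rightarrow> ereal"
  where "assouad_dim Z =
    Inf {ereal s | s. s \<ge> 0 \<and>
      (\<exists>C\<ge>1. \<forall>z\<in>Z. \<forall>r R. 0 < r \<and> r < R \<longrightarrow>
        ereal_of_enat (covering_number Z (rel_ball Z z R) r) \<le> ereal (C * (R / r) powr s))}"

end

theory Submission
  imports Defs
begin

text \<open>
  Fix \<open>s > d\<close>; it suffices to show that \<open>s\<close> is an admissible exponent for \<open>Y\<close>. Since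
  \<open>dim\<^sub>A X \<le> d < s\<close>, some \<open>t < s\<close> is admissible for \<open>X\<close>, with a constant \<open>C\<close>.

  The essential case is a ball of \<open>Y\<close> of radius \<open>\<rho>\<close> centred at a point of \<open>X\<close>. Split it, for a
  small \<open>\<epsilon>\<close>, at distance \<open>\<epsilon>\<rho>\<close> from \<open>X\<close>.
  \<^item> The far part is covered, by doubling, by boundedly many balls of radius \<open>\<epsilon>\<rho>/4\<close>. Those
    which meet the far part are so far from \<open>X\<close> relative to their radius that the hypothesis
    on \<open>Y - X\<close> applies to each of them (\<open>coverable_far_part\<close>).
  \<^item> The near part follows \<open>X\<close>: a cover of a ball of \<open>X\<close> by at most \<open>C (2/\<epsilon>)\<^sup>t\<close> balls of
    radius \<open>\<epsilon>\<rho>\<close>, with radii doubled, covers it (\<open>near_part_cover\<close>). The new balls are again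
    centred in \<open>X\<close>, which allows a recursion.

  So, writing \<open>N(\<rho>)\<close> for the number of \<open>r\<close>-balls needed,
  \<open>N(\<rho>) \<le> A (\<rho>/r)\<^sup>s + C (2/\<epsilon>)\<^sup>t N(2\<epsilon>\<rho>)\<close>. The bound \<open>N(\<rho>) \<le> K (\<rho>/r)\<^sup>s\<close> reproduces itself
  with a gain as soon as \<open>C (2/\<epsilon>)\<^sup>t (2\<epsilon>)\<^sup>s \<le> 1/2\<close>, and this holds for small \<open>\<epsilon>\<close> because
  \<open>s > t\<close>. This strict inequality is why the argument yields every \<open>s > d\<close> rather
  than \<open>s = d\<close>, which is enough for the dimension.

  A ball centred elsewhere is either so far from \<open>X\<close> that the hypothesis bounds it directly, or
  contained in a comparable ball centred in \<open>X\<close>.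
\<close>

section \<open>Covers by finitely many balls\<close>

text \<open>
  Covers are handled through their sets of centres, and the bound on their size is real, so that
  estimates such as \<open>C (R/r)\<^sup>s\<close> need no rounding.
\<close>

definition coverable :: "'a::metric_space set \<Rightarrow> 'a set \<Rightarrow> real \<Rightarrow> real \<Rightarrow> bool"
  where "coverable Z E r a \<longleftrightarrow>
    (\<exists>F. finite F \<and> F \<subseteq> Z \<and> real (card F) \<le> a \<and> E \<subseteq> (\<Union>c\<in>F. rel_ball Z c r))"

lemma coverableI:
  assumes "finite F" "F \<subseteq> Z" "real (card F) \<le> a" "E \<subseteq> (\<Union>c\<in>F. rel_ball Z c r)"
  shows "coverable Z E r a"
  using assms unfolding coverable_def by blast

lemma coverableE:
  assumes "coverable Z E r a"
  obtains F where "finite F" "F \<subseteq> Z" "real (card F) \<le> a" "E \<subseteq> (\<Union>c\<in>F. rel_ball Z c r)"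
  using assms unfolding coverable_def by blast

lemma covering_number_le_iff_coverable:
  "ereal_of_enat (covering_number Z E r) \<le> ereal a \<longleftrightarrow> coverable Z E r a"
proof
  let ?S = "{enat (card \<B>) | \<B>. finite \<B> \<and> \<B> \<subseteq> (\<lambda>z. rel_ball Z z r) ` Z \<and> E \<subseteq> \<Union>\<B>}"
  assume le: "ereal_of_enat (covering_number Z E r) \<le> ereal a"
  have "?S \<noteq> {}"
  proof
    assume "?S = {}"
    then have "covering_number Z E r = \<infinity>"
      unfolding covering_number_def by (simp only: Inf_enat_def) simp
    with le show False by simp
  qed
  then obtain n where "n \<in> ?S" by blast
  then have "Inf ?S \<in> ?S" by (rule wellorder_InfI)
  then obtain \<B> where \<B>: "covering_number Z E r = enat (card \<B>)" "finite \<B>"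
      "\<B> \<subseteq> (\<lambda>z. rel_ball Z z r) ` Z" "E \<subseteq> \<Union>\<B>"
    unfolding covering_number_def mem_Collect_eq by blast
  \<comment> \<open>Choosing one centre per ball keeps the cardinality.\<close>
  obtain F where F: "F \<subseteq> Z" "inj_on (\<lambda>z. rel_ball Z z r) F" "\<B> = (\<lambda>z. rel_ball Z z r) ` F"
    using \<B>(3) by (auto simp: subset_image_inj)
  show "coverable Z E r a"
  proof (rule coverableI)
    show "finite F" using F \<B>(2) by (simp add: finite_image_iff)
    show "real (card F) \<le> a" using le \<B>(1) F by (simp add: card_image)
  qed (use F \<B>(4) in auto)
next
  assume "coverable Z E r a"
  then obtain F where F: "finite F" "F \<subseteq> Z" "real (card F) \<le> a" "E \<subseteq> (\<Union>c\<in>F. rel_ball Z c r)"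
    by (rule coverableE)
  let ?\<B> = "(\<lambda>z. rel_ball Z z r) ` F"
  have "covering_number Z E r \<le> enat (card ?\<B>)"
    unfolding covering_number_def using F by (intro Inf_lower) blast
  also have "\<dots> \<le> enat (card F)"
    using F(1) by (simp add: card_image_le)
  finally have "ereal_of_enat (covering_number Z E r) \<le> ereal_of_enat (enat (card F))"
    by (simp only: ereal_of_enat_le_iff)
  also have "\<dots> \<le> ereal a" using F(3) by simp
  finally show "ereal_of_enat (covering_number Z E r) \<le> ereal a" .
qed

lemma coverable_mono:
  assumes "coverable Z E r a" "E' \<subseteq> E" "r \<le> r'" "a \<le> a'"
  shows "coverable Z E' r' a'"
  using assms(1)
proof (rule coverableE)
  fix F assume F: "finite F" "F \<subseteq> Z" "real (card F) \<le> a" "E \<subseteq> (\<Union>c\<in>F. rel_ball Z c r)"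
  have "rel_ball Z c r \<subseteq> rel_ball Z c r'" for c
    using assms(3) by (auto simp: rel_ball_def)
  with F assms(2,4) show ?thesis
    by (intro coverableI[of F]) (auto, blast)
qed

lemma coverable_rel_ball_one:
  assumes "z \<in> Z" "\<rho> \<le> r"
  shows "coverable Z (rel_ball Z z \<rho>) r 1"
  using assms by (intro coverableI[of "{z}"]) (auto simp: rel_ball_def)

lemma coverable_Un:
  assumes "coverable Z E r a" "coverable Z E' r b"
  shows "coverable Z (E \<union> E') r (a + b)"
proof -
  obtain F where F: "finite F" "F \<subseteq> Z" "real (card F) \<le> a" "E \<subseteq> (\<Union>c\<in>F. rel_ball Z c r)"
    using assms(1) by (rule coverableE)
  obtain G where G: "finite G" "G \<subseteq> Z" "real (card G) \<le> b" "E' \<subseteq> (\<Union>c\<in>G. rel_ball Z c r)"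
    using assms(2) by (rule coverableE)
  have "real (card (F \<union> G)) \<le> real (card F) + real (card G)"
    using card_Un_le[of F G] by linarith
  with F G show ?thesis
    by (intro coverableI[of "F \<union> G"]) auto
qed

lemma coverable_UN:
  assumes "finite I" "\<And>i. i \<in> I \<Longrightarrow> coverable Z (E i) r b"
  shows "coverable Z (\<Union>i\<in>I. E i) r (real (card I) * b)"
  using assms
proof (induction I rule: finite_induct)
  case empty
  show ?case by (rule coverableI[of "{}"]) auto
next
  case (insert i I)
  then have "coverable Z (E i \<union> (\<Union>i\<in>I. E i)) r (b + real (card I) * b)"
    by (intro coverable_Un) auto
  with insert.hyps show ?case by (simp add: algebra_simps)
qed

lemma coverable_bind:
  assumes "finite I" "real (card I) \<le> a" "0 \<le> b" "E \<subseteq> (\<Union>i\<in>I. E' i)"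
    and "\<And>i. i \<in> I \<Longrightarrow> coverable Z (E' i) r b"
  shows "coverable Z E r (a * b)"
proof (rule coverable_mono)
  show "coverable Z (\<Union>i\<in>I. E' i) r (real (card I) * b)"
    using assms(1,5) by (rule coverable_UN)
  show "real (card I) * b \<le> a * b" using assms(2,3) by (rule mult_right_mono)
qed (use assms in auto)

text \<open>Doubling is iterated, halving the radii until they are below \<open>\<epsilon>\<rho>\<close>.\<close>

lemma doubling_coverable:
  fixes Z :: "'a::metric_space set"
  assumes "doubling Z" "0 < \<epsilon>"
  obtains M where "0 \<le> M"
    "\<And>z \<rho>. z \<in> Z \<Longrightarrow> 0 < \<rho> \<Longrightarrow> coverable Z (rel_ball Z z \<rho>) (\<epsilon> * \<rho>) M"
proof -
  obtain D :: nat where D: "\<And>z R. z \<in> Z \<Longrightarrow> 0 < R \<Longrightarrow>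
      covering_number Z (rel_ball Z z R) (R / 2) \<le> enat D"
    using assms(1) unfolding doubling_def by blast
  have half: "coverable Z (rel_ball Z z R) (R / 2) (real D)" if "z \<in> Z" "0 < R" for z R
  proof -
    have "ereal_of_enat (covering_number Z (rel_ball Z z R) (R / 2)) \<le> ereal_of_enat (enat D)"
      using D[OF that] by (simp only: ereal_of_enat_le_iff)
    then show ?thesis by (simp add: covering_number_le_iff_coverable)
  qed
  have halves: "coverable Z (rel_ball Z z \<rho>) (\<rho> / 2 ^ k) (real D ^ k)"
    if "z \<in> Z" "0 < \<rho>" for z \<rho> k
  proof (induction k)
    case 0
    show ?case using coverable_rel_ball_one[OF that(1) order_refl] by simp
  next
    case (Suc k)
    then obtain F where F: "finite F" "F \<subseteq> Z" "real (card F) \<le> real D ^ k"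
        "rel_ball Z z \<rho> \<subseteq> (\<Union>c\<in>F. rel_ball Z c (\<rho> / 2 ^ k))"
      by (rule coverableE)
    have "coverable Z (rel_ball Z z \<rho>) (\<rho> / 2 ^ k / 2) (real D ^ k * real D)"
    proof (rule coverable_bind[OF F(1,3) _ F(4)])
      fix c assume "c \<in> F"
      then show "coverable Z (rel_ball Z c (\<rho> / 2 ^ k)) (\<rho> / 2 ^ k / 2) (real D)"
        using F(2) that(2) by (intro half) auto
    qed simp
    then show ?case by (simp add: mult_ac)
  qed
  obtain k where k: "(1 / 2) ^ k < \<epsilon>"
    using real_arch_pow_inv[of \<epsilon> "1 / 2"] assms(2) by auto
  show ?thesis
  proof (rule that)
    fix z \<rho> assume z: "z \<in> Z" "0 < (\<rho>::real)"
    have "(1 / 2) ^ k * \<rho> \<le> \<epsilon> * \<rho>" using k z(2) by (intro mult_right_mono) auto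
    then have "\<rho> / 2 ^ k \<le> \<epsilon> * \<rho>" by (simp add: power_divide)
    with halves[OF z, of k] show "coverable Z (rel_ball Z z \<rho>) (\<epsilon> * \<rho>) (real D ^ k)"
      by (auto intro: coverable_mono)
  qed simp
qed

lemma infdist_lt_obtain:
  assumes "X \<noteq> {}" "infdist y X < b"
  obtains x where "x \<in> X" "dist y x < b"
proof -
  have "(INF x\<in>X. dist y x) < b"
    using assms by (simp add: infdist_notempty)
  then show ?thesis
    using assms(1) that by (auto simp: cINF_less_iff)
qed

section \<open>Balls centred in the closed subset\<close>

text \<open>
  A ball of radius \<open>\<epsilon>\<rho>/4\<close> which meets the far part has its centre at distance at least
  \<open>3\<epsilon>\<rho>/4\<close> from \<open>X\<close>, more than twice its radius; this is what makes the hypothesis applicable.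
\<close>

lemma coverable_far_part:
  fixes X Y :: "'a::metric_space set"
  assumes "doubling Y" "0 \<le> C\<^sub>0" "d \<le> s" "0 \<le> s" "0 < \<epsilon>" "\<epsilon> \<le> 1"
    and away: "\<And>y R r. y \<in> Y - X \<Longrightarrow> 0 < R \<Longrightarrow> R < infdist y X / 2 \<Longrightarrow> 0 < r \<Longrightarrow> r < R \<Longrightarrow>
      coverable Y (rel_ball Y y R) r (C\<^sub>0 * (R / r) powr d)"
  obtains A where "0 \<le> A"
    "\<And>x \<rho> r. x \<in> Y \<Longrightarrow> 0 < r \<Longrightarrow> r \<le> \<rho> \<Longrightarrow>
      coverable Y {y \<in> rel_ball Y x \<rho>. \<epsilon> * \<rho> \<le> infdist y X} r (A * (\<rho> / r) powr s)"
proof -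
  obtain M where M: "0 \<le> M"
    "\<And>z \<rho>. z \<in> Y \<Longrightarrow> 0 < \<rho> \<Longrightarrow> coverable Y (rel_ball Y z \<rho>) (\<epsilon> / 4 * \<rho>) M"
    using doubling_coverable[OF assms(1), of "\<epsilon> / 4"] assms(5) by auto
  show ?thesis
    \<comment> \<open>The summand \<open>1\<close> accounts for \<open>r\<close> so large that one \<open>r\<close>-ball replaces each small ball.\<close>
  proof (rule that[of "M * (C\<^sub>0 + 1)"])
    fix x \<rho> r assume x: "x \<in> Y" and r: "0 < r" "r \<le> (\<rho>::real)"
    define R where "R = \<epsilon> / 4 * \<rho>"
    have R: "0 < R" "R \<le> \<rho>"
      using r assms(5,6) mult_right_mono[of "\<epsilon> / 4" 1 \<rho>] by (auto simp: R_def)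
    let ?E = "{y \<in> rel_ball Y x \<rho>. \<epsilon> * \<rho> \<le> infdist y X}"
    obtain F where F: "finite F" "F \<subseteq> Y" "real (card F) \<le> M"
        "rel_ball Y x \<rho> \<subseteq> (\<Union>c\<in>F. rel_ball Y c R)"
      using M(2)[OF x, of \<rho>] r unfolding R_def by (auto elim: coverableE)
    define G where "G = {c \<in> F. rel_ball Y c R \<inter> ?E \<noteq> {}}"
    have pow1: "1 \<le> (\<rho> / r) powr s"
      using r assms(4) by (intro ge_one_powr_ge_zero) auto
    have "coverable Y ?E r (M * ((C\<^sub>0 + 1) * (\<rho> / r) powr s))"
    proof (rule coverable_bind)
      show "finite G" using F(1) by (simp add: G_def)
      have "card G \<le> card F" using F(1) by (intro card_mono) (auto simp: G_def)
      then show "real (card G) \<le> M" using F(3) by linarith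
      show "0 \<le> (C\<^sub>0 + 1) * (\<rho> / r) powr s" using assms(2) by simp
      show "?E \<subseteq> (\<Union>c\<in>G. rel_ball Y c R)" using F(4) by (fastforce simp: G_def)
    next
      fix c assume "c \<in> G"
      then obtain y where "y \<in> rel_ball Y c R" and "y \<in> ?E" and c: "c \<in> Y"
        using F(2) by (auto simp: G_def)
      then have y: "dist c y < R" "\<epsilon> * \<rho> \<le> infdist y X"
        by (auto simp: rel_ball_def)
      have "infdist y X \<le> infdist c X + dist y c" by (rule infdist_triangle)
      then have inf: "R < infdist c X / 2"
        using y R(1) by (simp add: R_def dist_commute)
      with R(1) have "c \<notin> X" by auto
      show "coverable Y (rel_ball Y c R) r ((C\<^sub>0 + 1) * (\<rho> / r) powr s)"
      proof (cases "r < R")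
        case True
        have "(R / r) powr d \<le> (R / r) powr s"
          using True r(1) assms(3) by (intro powr_mono) auto
        also have "\<dots> \<le> (\<rho> / r) powr s"
          using R r(1) assms(4) by (intro powr_mono2) (auto simp: divide_right_mono)
        finally have "C\<^sub>0 * (R / r) powr d \<le> (C\<^sub>0 + 1) * (\<rho> / r) powr s"
          using assms(2) by (intro mult_mono) auto
        with away[of c R r] c \<open>c \<notin> X\<close> R(1) inf r(1) True show ?thesis
          by (blast intro: coverable_mono)
      next
        case False
        have "1 * 1 \<le> (C\<^sub>0 + 1) * (\<rho> / r) powr s"
          using pow1 assms(2) by (intro mult_mono) auto
        with False coverable_rel_ball_one[OF c, of R r] show ?thesis
          by (auto intro: coverable_mono)
      qed
    qed
    then show "coverable Y ?E r (M * (C\<^sub>0 + 1) * (\<rho> / r) powr s)"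
      by (simp add: mult.assoc)
  qed (use M(1) assms(2) in simp)
qed

text \<open>
  A point close to \<open>X\<close> is replaced by a nearby point of \<open>X\<close>, which a ball of \<open>X\<close> of
  radius \<open>\<epsilon>\<rho>\<close> captures; twice that radius then captures the point itself. The passage
  from \<open>\<rho>\<close> to \<open>2\<rho>\<close> makes room for the replacement.
\<close>

lemma near_part_cover:
  fixes X Y :: "'a::metric_space set"
  assumes "X \<subseteq> Y" "x \<in> X" "0 < \<rho>" "0 < \<epsilon>" "\<epsilon> \<le> 1"
    and cov: "coverable X (rel_ball X x (2 * \<rho>)) (\<epsilon> * \<rho>) a"
  obtains F where "finite F" "F \<subseteq> X" "real (card F) \<le> a"
    "{y \<in> rel_ball Y x \<rho>. infdist y X < \<epsilon> * \<rho>} \<subseteq> (\<Union>c\<in>F. rel_ball Y c (2 * \<epsilon> * \<rho>))"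
proof -
  obtain F where F: "finite F" "F \<subseteq> X" "real (card F) \<le> a"
      "rel_ball X x (2 * \<rho>) \<subseteq> (\<Union>c\<in>F. rel_ball X c (\<epsilon> * \<rho>))"
    using cov by (rule coverableE)
  have "y \<in> (\<Union>c\<in>F. rel_ball Y c (2 * \<epsilon> * \<rho>))"
    if y: "y \<in> rel_ball Y x \<rho>" "infdist y X < \<epsilon> * \<rho>" for y
  proof -
    obtain x' where x': "x' \<in> X" "dist y x' < \<epsilon> * \<rho>"
      using infdist_lt_obtain[OF _ y(2)] assms(2) by blast
    have "\<epsilon> * \<rho> \<le> \<rho>" using assms(3,5) by simp
    moreover have "dist x x' \<le> dist x y + dist y x'" by (rule dist_triangle)
    ultimately have "x' \<in> rel_ball X x (2 * \<rho>)"
      using x' y(1) by (simp add: rel_ball_def)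
    then obtain c where c: "c \<in> F" "dist c x' < \<epsilon> * \<rho>"
      using F(4) by (auto simp: rel_ball_def)
    have "dist c y \<le> dist c x' + dist y x'" by (rule dist_triangle2)
    then have "dist c y < 2 * \<epsilon> * \<rho>" using c(2) x'(2) by simp
    with c(1) y(1) show ?thesis by (auto simp: rel_ball_def)
  qed
  then show ?thesis using that F(1-3) by blast
qed

text \<open>
  The product is \<open>C 2\<^bsup>t+s\<^esup> \<epsilon>\<^bsup>s-t\<^esup>\<close>, which tends to \<open>0\<close> with \<open>\<epsilon>\<close>.
\<close>

lemma exists_contracting_scale:
  fixes s t C :: real
  assumes "t < s" "0 < C"
  obtains \<epsilon> where "0 < \<epsilon>" "\<epsilon> \<le> 1 / 4" "C * (2 / \<epsilon>) powr t * (2 * \<epsilon>) powr s \<le> 1 / 2"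
proof -
  define c where "c = 2 * C * 2 powr (t + s)"
  have c: "0 < c" using assms by (simp add: c_def)
  define \<epsilon> where "\<epsilon> = min (1 / 4) ((1 / c) powr (1 / (s - t)))"
  have \<epsilon>: "0 < \<epsilon>" "\<epsilon> \<le> 1 / 4" using c by (auto simp: \<epsilon>_def)
  have "\<epsilon> powr (s - t) \<le> ((1 / c) powr (1 / (s - t))) powr (s - t)"
    using \<epsilon>(1) assms by (intro powr_mono2) (auto simp: \<epsilon>_def)
  also have "\<dots> = 1 / c" using c assms by (simp add: powr_powr)
  finally have "c * \<epsilon> powr (s - t) \<le> 1" using c by (simp add: field_simps)
  moreover have "C * (2 / \<epsilon>) powr t * (2 * \<epsilon>) powr s = c * \<epsilon> powr (s - t) / 2"
    using \<epsilon>(1) by (simp add: c_def powr_divide powr_mult powr_add powr_diff)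
  ultimately show ?thesis using that[OF \<epsilon>] by linarith
qed

text \<open>
  The recursion passes from radius \<open>\<rho>\<close> to radius \<open>2\<epsilon>\<rho> \<le> \<rho>/2\<close>, so the number of halvings that
  bring \<open>\<rho>\<close> down to \<open>r\<close> serves as the induction parameter. The constant \<open>K\<close> does not depend on it:
  the contraction compensates, at each stage, for the many balls in the cover of the near part.
\<close>

lemma coverable_ball_centred_in_subset:
  fixes X Y :: "'a::metric_space set"
  assumes "doubling Y" "X \<subseteq> Y" "0 \<le> C\<^sub>0" "d \<le> s" "0 \<le> t" "t < s" "0 < C"
    and X: "\<And>x R r. x \<in> X \<Longrightarrow> 0 < r \<Longrightarrow> r < R \<Longrightarrow>
      coverable X (rel_ball X x R) r (C * (R / r) powr t)"
    and away: "\<And>y R r. y \<in> Y - X \<Longrightarrow> 0 < R \<Longrightarrow> R < infdist y X / 2 \<Longrightarrow> 0 < r \<Longrightarrow> r < R \<Longrightarrow>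
      coverable Y (rel_ball Y y R) r (C\<^sub>0 * (R / r) powr d)"
  obtains K where "0 \<le> K"
    "\<And>x \<rho> r. x \<in> X \<Longrightarrow> 0 < r \<Longrightarrow> r < \<rho> \<Longrightarrow>
      coverable Y (rel_ball Y x \<rho>) r (K * (\<rho> / r) powr s)"
proof -
  obtain \<epsilon> where \<epsilon>: "0 < \<epsilon>" "\<epsilon> \<le> 1 / 4" "C * (2 / \<epsilon>) powr t * (2 * \<epsilon>) powr s \<le> 1 / 2"
    using exists_contracting_scale[OF assms(6,7)] .
  obtain A where A: "0 \<le> A"
    "\<And>x \<rho> r. x \<in> Y \<Longrightarrow> 0 < r \<Longrightarrow> r \<le> \<rho> \<Longrightarrow>
      coverable Y {y \<in> rel_ball Y x \<rho>. \<epsilon> * \<rho> \<le> infdist y X} r (A * (\<rho> / r) powr s)"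
    using coverable_far_part[OF assms(1,3,4), of \<epsilon> X] assms(5,6) \<epsilon> away by auto
  define B where "B = C * (2 / \<epsilon>) powr t"
  have B: "0 \<le> B" using assms(7) by (simp add: B_def)
  \<comment> \<open>\<open>2 * A\<close> absorbs the far part thanks to the contraction factor \<open>1/2\<close>; \<open>B\<close> pays for the
    last step, in which every ball of radius \<open>2\<epsilon>\<rho>\<close> is a single \<open>r\<close>-ball.\<close>
  define K where "K = 2 * A + B"
  have K: "0 \<le> K" using A(1) B by (simp add: K_def)
  have main: "coverable Y (rel_ball Y x \<rho>) r (K * (\<rho> / r) powr s)"
    if "0 < r" "x \<in> X" "r < \<rho>" "\<rho> \<le> r * 2 ^ n" for r x \<rho> n
    using that(2-4)
  proof (induction n arbitrary: x \<rho>)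
    case 0
    then show ?case by simp
  next
    case (Suc n)
    have \<rho>: "0 < \<rho>" using Suc.prems(2) that(1) by linarith
    let ?q = "(\<rho> / r) powr s"
    have q1: "1 \<le> ?q"
      using Suc.prems(2) that(1) assms(5,6) by (intro ge_one_powr_ge_zero) auto
    have "coverable X (rel_ball X x (2 * \<rho>)) (\<epsilon> * \<rho>) (C * (2 * \<rho> / (\<epsilon> * \<rho>)) powr t)"
      using Suc.prems(1) \<rho> \<epsilon> by (intro X) auto
    then have "coverable X (rel_ball X x (2 * \<rho>)) (\<epsilon> * \<rho>) B"
      using \<rho> by (simp add: B_def)
    then obtain F where F: "finite F" "F \<subseteq> X" "real (card F) \<le> B"
      "{y \<in> rel_ball Y x \<rho>. infdist y X < \<epsilon> * \<rho>} \<subseteq> (\<Union>c\<in>F. rel_ball Y c (2 * \<epsilon> * \<rho>))"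
      using near_part_cover[OF assms(2) Suc.prems(1) \<rho> \<epsilon>(1)] \<epsilon>(2) by auto
    have near: "coverable Y {y \<in> rel_ball Y x \<rho>. infdist y X < \<epsilon> * \<rho>} r ((A + B) * ?q)"
    proof (cases "r < 2 * \<epsilon> * \<rho>")
      case True
      have scale: "2 * \<epsilon> * \<rho> \<le> r * 2 ^ n"
      proof -
        have "2 * \<epsilon> * \<rho> \<le> 1 / 2 * \<rho>" using \<epsilon>(2) \<rho> by (intro mult_right_mono) auto
        then show ?thesis using Suc.prems(3) by simp
      qed
      have "coverable Y {y \<in> rel_ball Y x \<rho>. infdist y X < \<epsilon> * \<rho>} r
          (B * (K * (2 * \<epsilon> * \<rho> / r) powr s))"
        using F K Suc.IH[OF _ True scale] by (intro coverable_bind[OF F(1,3) _ F(4)]) auto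
      moreover have "B * (K * (2 * \<epsilon> * \<rho> / r) powr s) \<le> (A + B) * ?q"
      proof -
        have "(2 * \<epsilon> * \<rho> / r) powr s = (2 * \<epsilon>) powr s * ?q"
          using \<epsilon>(1) \<rho> that(1) powr_mult[of "2 * \<epsilon>" "\<rho> / r" s] by simp
        then have "B * (K * (2 * \<epsilon> * \<rho> / r) powr s) = (B * (2 * \<epsilon>) powr s) * (K * ?q)"
          by simp
        also have "\<dots> \<le> 1 / 2 * (K * ?q)"
          using \<epsilon>(3) K by (intro mult_right_mono) (auto simp: B_def)
        also have "\<dots> = (A + B / 2) * ?q" by (simp add: K_def algebra_simps)
        also have "\<dots> \<le> (A + B) * ?q" using B by (intro mult_right_mono) auto
        finally show ?thesis .
      qed
      ultimately show ?thesis by (auto intro: coverable_mono)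
    next
      case False
      have "coverable Y {y \<in> rel_ball Y x \<rho>. infdist y X < \<epsilon> * \<rho>} r (B * 1)"
        using F(2) False assms(2)
        by (intro coverable_bind[OF F(1,3) _ F(4)] coverable_rel_ball_one) auto
      moreover have "B * 1 \<le> (A + B) * ?q"
        using A(1) B q1 by (intro mult_mono) auto
      ultimately show ?thesis by (auto intro: coverable_mono)
    qed
    have far: "coverable Y {y \<in> rel_ball Y x \<rho>. \<epsilon> * \<rho> \<le> infdist y X} r (A * ?q)"
      using Suc.prems assms(2) that(1) by (intro A(2)) auto
    show ?case
    proof (rule coverable_mono[OF coverable_Un[OF far near]])
      show "A * ?q + (A + B) * ?q \<le> K * ?q" by (simp add: K_def algebra_simps)
    qed auto
  qed
  show ?thesis
  proof (rule that[OF K])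
    fix x \<rho> r assume x: "x \<in> X" and r: "0 < r" "r < (\<rho>::real)"
    obtain n where "\<rho> / r < 2 ^ n"
      using real_arch_pow[of 2 "\<rho> / r"] by auto
    then have "\<rho> \<le> r * 2 ^ n" using r(1) by (simp add: field_simps)
    with main x r show "coverable Y (rel_ball Y x \<rho>) r (K * (\<rho> / r) powr s)" by blast
  qed
qed

section \<open>The Assouad dimension\<close>

lemma assouad_dim_lt_obtain:
  assumes "assouad_dim Z < ereal s"
  obtains t C where "0 \<le> t" "t < s" "1 \<le> C"
    "\<And>z r R. z \<in> Z \<Longrightarrow> 0 < r \<Longrightarrow> r < R \<Longrightarrow> coverable Z (rel_ball Z z R) r (C * (R / r) powr t)"
  using assms unfolding assouad_dim_def Inf_less_iff covering_number_le_iff_coverable by force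

lemma assouad_dim_leI:
  assumes "0 \<le> s" "1 \<le> C"
    "\<And>z r R. z \<in> Z \<Longrightarrow> 0 < r \<Longrightarrow> r < R \<Longrightarrow> coverable Z (rel_ball Z z R) r (C * (R / r) powr s)"
  shows "assouad_dim Z \<le> ereal s"
  unfolding assouad_dim_def covering_number_le_iff_coverable
  using assms by (intro Inf_lower) blast

theorem lemma2p9:
  fixes X Y :: "'a::metric_space set" and d C\<^sub>0 :: real
  assumes "doubling Y"
    and "X \<subseteq> Y" and "X \<noteq> {}" and "closedin (top_of_set Y) X"
    and "assouad_dim X \<le> ereal d"
    and "C\<^sub>0 \<ge> 1"
    and "\<And>y R r. y \<in> Y - X \<Longrightarrow> 0 < R \<Longrightarrow> R < infdist y X / 2 \<Longrightarrow> 0 < r \<Longrightarrow> r < R \<Longrightarrow>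
      ereal_of_enat (covering_number Y (rel_ball Y y R) r) \<le> ereal (C\<^sub>0 * (R / r) powr d)"
  shows "assouad_dim Y \<le> ereal d"
proof (rule dense_ge)
  have dimension_bound: "assouad_dim Y \<le> ereal s" if ds: "d < s" for s
  proof -
    have "assouad_dim X < ereal s" using assms(5) ds by (simp add: order_le_less_trans)
    then obtain t C where t: "0 \<le> t" "t < s" "1 \<le> C"
      and X: "\<And>x r R. x \<in> X \<Longrightarrow> 0 < r \<Longrightarrow> r < R \<Longrightarrow>
        coverable X (rel_ball X x R) r (C * (R / r) powr t)"
      using assouad_dim_lt_obtain by blast
    have away: "\<And>y R r. y \<in> Y - X \<Longrightarrow> 0 < R \<Longrightarrow> R < infdist y X / 2 \<Longrightarrow> 0 < r \<Longrightarrow> r < R \<Longrightarrow>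
        coverable Y (rel_ball Y y R) r (C\<^sub>0 * (R / r) powr d)"
      using assms(7) by (simp only: covering_number_le_iff_coverable)
    obtain K where K: "0 \<le> K" "\<And>x \<rho> r. x \<in> X \<Longrightarrow> 0 < r \<Longrightarrow> r < \<rho> \<Longrightarrow>
        coverable Y (rel_ball Y x \<rho>) r (K * (\<rho> / r) powr s)"
      using coverable_ball_centred_in_subset[OF assms(1,2) _ _ t(1,2) _ X away] assms(6) ds t(3)
      by auto
    define L where "L = K * 4 powr s"
    have L: "0 \<le> L" using K(1) by (simp add: L_def)
    show ?thesis
    proof (rule assouad_dim_leI)
      show "0 \<le> s" using t by simp
      show "1 \<le> C\<^sub>0 + L" using assms(6) L by simp
    next
      fix y r R assume y: "y \<in> Y" and r: "0 < r" "r < (R::real)"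
      show "coverable Y (rel_ball Y y R) r ((C\<^sub>0 + L) * (R / r) powr s)"
      proof (cases "R < infdist y X / 2")
        case True
        then have "y \<notin> X" using r by auto
        then have "coverable Y (rel_ball Y y R) r (C\<^sub>0 * (R / r) powr d)"
          using y r True by (intro away) auto
        moreover have "C\<^sub>0 * (R / r) powr d \<le> (C\<^sub>0 + L) * (R / r) powr s"
          using assms(6) L r ds by (intro mult_mono powr_mono) auto
        ultimately show ?thesis by (auto intro: coverable_mono)
      next
        case False
        then obtain x where x: "x \<in> X" "dist y x < 3 * R"
          using infdist_lt_obtain[OF assms(3), of y "3 * R"] r by auto
        have "rel_ball Y y R \<subseteq> rel_ball Y x (4 * R)"
        proof
          fix z assume z: "z \<in> rel_ball Y y R"
          have "dist x z \<le> dist y x + dist y z" by (rule dist_triangle3)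
          with x(2) z show "z \<in> rel_ball Y x (4 * R)" by (simp add: rel_ball_def)
        qed
        moreover have "coverable Y (rel_ball Y x (4 * R)) r (K * (4 * R / r) powr s)"
          using x(1) r by (intro K(2)) auto
        moreover have "K * (4 * R / r) powr s \<le> (C\<^sub>0 + L) * (R / r) powr s"
        proof -
          have "K * (4 * R / r) powr s = L * (R / r) powr s"
            using r powr_mult[of 4 "R / r" s] by (simp add: L_def)
          also have "\<dots> \<le> (C\<^sub>0 + L) * (R / r) powr s"
            using assms(6) by (intro mult_right_mono) auto
          finally show ?thesis .
        qed
        ultimately show ?thesis by (auto intro: coverable_mono)
      qed
    qed
  qed
  fix e assume "ereal d < e"
  then show "assouad_dim Y \<le> e"
    using dimension_bound by (cases e) auto
qed

end
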